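(* Let $\eta_i=m_i+\varepsilon_i$, $i=1,\dots,n$, be observations in a real, separable, infinite dimensional Hilbert space $H$ following the signal plus noise model described in the context, and let $d\in\mathbb{N}$ and $\gamma\in(0,1/2)$. Let $\hat{\mathscr{C}}=\hat{\mathscr{C}}_n$ be self-adjoint Hilbert-Schmidt operator valued estimates whose largest eigenvalue satisfies $\hat\lambda_1=o_P(n)$ as $n\to\infty$, and assume that $\max_{1\le k<n}\|S_k(\varepsilon)\|=\mathcal{O}_P(1)$ as $n\to\infty$. Then the statistic $\hat{\mathscr{T}}^{(d)\prime}$ based on the change-aligned first principal component $\hat v_1'$ satisfies under $H_A$ $$\lim_{n\to\infty}P(\hat{\mathscr{T}}^{(d)\prime}>t)=1$$ for any $t\in\mathbb{R}$.
   Context: Model. $\eta_i=m_i+\varepsilon_i$ with $m_i=g(i/n)\Delta$, $i=1,\dots,n$, where $\Delta\in H$, $\|\Delta\|=1$, $g:[0,1]\to\mathbb{R}$ is piecewise Lipschitz continuous, and $\{\varepsilon_i\}_{i\in\mathbb{Z}}$ is a centered, strictly stationary $H$-valued time series with $E\|\varepsilon_1\|^2<\infty$. With $(x\otimes y)z=\langle y,z\rangle x$, $\mathscr{C}_h=E[\varepsilon_0\otimes\varepsilon_h]$ and $\|\cdot\|_{\mathcal S}$ the Hilbert-Schmidt norm, it is assumed that $\sum_{h\in\mathbb{Z}}\|\mathscr{C}_h\|_{\mathcal S}<\infty$, and that the $d$-th largest eigenvalue $\lambda_d$ of $\mathscr{C}=\sum_h\mathscr{C}_h$ is positive. The alternative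 $H_A$ is that $g$ is non-constant on $[0,1]$, in the sense that $\sup_{0\le x\le1}\big|\int_0^xg(y)\,dy-x\int_0^1g(y)\,dy\big|>0$ (i.e. $g$ is not almost everywhere equal to a constant). Spectral decomposition: $\hat{\mathscr{C}}=\sum_j\hat\lambda_j(\hat v_j\otimes\hat v_j)$ with real eigenvalues $\hat\lambda_1\ge\hat\lambda_2\ge\dots$ (not assumed non-negative) and an orthonormal basis $\{\hat v_j\}$ of $H$. For a (Hilbert space or $\mathbb{R}^d$ valued) series $x_1,\dots,x_n$ put $S_k(x)=n^{-1/2}\sum_{i=1}^k(x_i-\bar x_n)$, $\bar x_n=n^{-1}\sum_{i=1}^nx_i$. Change-aligned component: $$\hat v_1'=\frac{\hat v_1/n^\gamma+\hat s\hat u}{\|\hat v_1/n^\gamma+\hat s\hat u\|},\qquad \hat u=S_{\hat k}(\eta)/n^{1/2},\quad \hat s=\operatorname{sign}\langle\hat v_1,\hat u\rangle,$$ where $\hat k\in\{1,\dots,n-1\}$ is chosen such that $\|S_{\hat k}(\eta)\|=\max_{1\le k<n}\|S_k(\eta)\|$, and $\operatorname{sign}$ takes values in $\{-1,1\}$ (with $\operatorname{sign}(0):=1$). With $|\cdot|$ the Euclidean norm, the adjusted statistic is $$\hat{\mathscr{T}}^{(d)\prime}=\max_{1\le k<n}|\hat\Sigma^{-1/2}S_k(\hat{\boldsymbol{\eta}}')|,\quad \hat{\boldsymbol{\eta}}_i'=[\langle\eta_i,\hat v_1'\rangle,\langle\eta_i,\hat v_2\rangle,\dots,\langle\eta_i,\hat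 v_d\rangle]',\quad \hat\Sigma=\operatorname{diag}(|\hat\lambda_1|,\dots,|\hat\lambda_d|),$$ with $\hat{\mathscr{T}}^{(d)\prime}:=\infty$ if $\hat\lambda_j=0$ for some $1\le j\le d$. *)

theory Defs
  imports "HOL-Probability.Probability" "HOL-Analysis.Lipschitz"
begin

text \<open>
  A real separable Hilbert space is a type of sort
  \<open>{real_inner, banach, second_countable_topology}\<close>; for metric spaces second countability is
  separability. Components and eigenvalues are indexed from 0, so the \<open>j\<close>-th eigenvalue of the usual
  notation is \<open>lam (j - 1)\<close>. Observations are indexed from 1.
\<close>

subsection \<open>Operators on a Hilbert space\<close>

definition orthonormal_basis :: "(nat \<Rightarrow> 'h::real_inner) \<Rightarrow> bool" where
  "orthonormal_basis e \<longleftrightarrow>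
     (\<forall>i j. inner (e i) (e j) = (if i = j then 1 else 0)) \<and> closure (span (range e)) = UNIV"

text \<open>
  The Hilbert-Schmidt property and norm do not depend on the orthonormal basis used to compute
  them; one is therefore fixed by choice. It exists in every infinite dimensional separable
  Hilbert space.
\<close>

definition some_onb :: "nat \<Rightarrow> 'h::real_inner" where
  "some_onb = (SOME e. orthonormal_basis e)"

definition hilbert_schmidt :: "('h::real_inner \<Rightarrow> 'h) \<Rightarrow> bool" where
  "hilbert_schmidt A \<longleftrightarrow> bounded_linear A \<and> summable (\<lambda>j. (norm (A (some_onb j)))\<^sup>2)"

definition hs_norm :: "('h::real_inner \<Rightarrow> 'h) \<Rightarrow> real" where
  "hs_norm A = sqrt (\<Sum>j. (norm (A (some_onb j)))\<^sup>2)"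

definition self_adjoint :: "('h::real_inner \<Rightarrow> 'h) \<Rightarrow> bool" where
  "self_adjoint A \<longleftrightarrow> (\<forall>x y. inner (A x) y = inner x (A y))"

definition tensor :: "'h::real_inner \<Rightarrow> 'h \<Rightarrow> 'h \<Rightarrow> 'h" where
  "tensor x y z = inner y z *\<^sub>R x"

text \<open>
  \<open>A = (\<Sum>j. lam j (v j \<otimes> v j))\<close> with an orthonormal basis \<open>v\<close>, where \<open>lam 0 \<ge> \<dots> \<ge> lam (d - 1)\<close> are
  the \<open>d\<close> largest eigenvalues, counted with multiplicity. The remaining eigenvalues may be listed
  in any order. This is deliberate: they tend to 0, so demanding that the whole sequence be
  nonincreasing would exclude every operator with a negative eigenvalue.
\<close>

definition spectral_decomposition ::
    "nat \<Rightarrow> ('h::real_inner \<Rightarrow> 'h) \<Rightarrow> (nat \<Rightarrow> real) \<Rightarrow> (nat \<Rightarrow> 'h) \<Rightarrow> bool" where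
  "spectral_decomposition d A lam v \<longleftrightarrow>
     orthonormal_basis v \<and>
     (\<forall>z. (\<lambda>j. lam j *\<^sub>R tensor (v j) (v j) z) sums A z) \<and>
     (\<forall>i<d. \<forall>j\<ge>i. lam j \<le> lam i)"

subsection \<open>Stochastic notions\<close>

definition strictly_stationary ::
    "'w measure \<Rightarrow> (int \<Rightarrow> 'w \<Rightarrow> 'h::topological_space) \<Rightarrow> bool" where
  "strictly_stationary M X \<longleftrightarrow>
     (\<forall>I h. finite I \<longrightarrow>
        distr M (Pi\<^sub>M I (\<lambda>_. borel)) (\<lambda>\<omega>. \<lambda>i\<in>I. X (i + h) \<omega>) =
        distr M (Pi\<^sub>M I (\<lambda>_. borel)) (\<lambda>\<omega>. \<lambda>i\<in>I. X i \<omega>))"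

definition small_o_P :: "'w measure \<Rightarrow> (nat \<Rightarrow> 'w \<Rightarrow> real) \<Rightarrow> (nat \<Rightarrow> real) \<Rightarrow> bool" where
  "small_o_P M X a \<longleftrightarrow>
     (\<forall>\<delta>>0. (\<lambda>n. measure M {\<omega> \<in> space M. \<bar>X n \<omega>\<bar> > \<delta> * a n}) \<longlonglongrightarrow> 0)"

definition big_O_P :: "'w measure \<Rightarrow> (nat \<Rightarrow> 'w \<Rightarrow> real) \<Rightarrow> (nat \<Rightarrow> real) \<Rightarrow> bool" where
  "big_O_P M X a \<longleftrightarrow>
     (\<forall>\<delta>>0. \<exists>K. \<forall>\<^sub>F n in sequentially. measure M {\<omega> \<in> space M. \<bar>X n \<omega>\<bar> > K * a n} < \<delta>)"

text \<open>
  Expectations of operators are taken pointwise, and so is the sum over all lags. Under a finite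
  second moment the lagged covariance operators are Hilbert-Schmidt and the pointwise expectation
  agrees with the one in the Hilbert-Schmidt space; if the Hilbert-Schmidt norms are summable,
  the same holds for the sum.
\<close>

definition autocov ::
    "'w measure \<Rightarrow> (int \<Rightarrow> 'w \<Rightarrow> 'h::{real_inner, banach, second_countable_topology}) \<Rightarrow>
       int \<Rightarrow> 'h \<Rightarrow> 'h" where
  "autocov M \<epsilon> h z = (\<integral>\<omega>. tensor (\<epsilon> 0 \<omega>) (\<epsilon> h \<omega>) z \<partial>M)"

definition long_run_cov ::
    "'w measure \<Rightarrow> (int \<Rightarrow> 'w \<Rightarrow> 'h::{real_inner, banach, second_countable_topology}) \<Rightarrow>
       'h \<Rightarrow> 'h" where
  "long_run_cov M \<epsilon> z = (\<Sum>\<^sub>\<infinity>h\<in>UNIV. autocov M \<epsilon> h z)"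

subsection \<open>The signal\<close>

text \<open>Values at the break points are unrestricted.\<close>

definition piecewise_lipschitz :: "(real \<Rightarrow> real) \<Rightarrow> bool" where
  "piecewise_lipschitz g \<longleftrightarrow>
     (\<exists>(m::nat) t. t 0 = 0 \<and> t m = 1 \<and>
        (\<forall>i<m. t i < t (Suc i) \<and> (\<exists>L. L-lipschitz_on {t i<..<t (Suc i)} g)))"

text \<open>Non-constancy of the signal; the supremum is over a bounded set for piecewise Lipschitz \<open>g\<close>.\<close>

definition alternative_HA :: "(real \<Rightarrow> real) \<Rightarrow> bool" where
  "alternative_HA g \<longleftrightarrow>
     (SUP x\<in>{0..1}. \<bar>integral {0..x} g - x * integral {0..1} g\<bar>) > 0"

definition observation ::
    "(real \<Rightarrow> real) \<Rightarrow> 'h::real_vector \<Rightarrow> (int \<Rightarrow> 'w \<Rightarrow> 'h) \<Rightarrow> nat \<Rightarrow> 'w \<Rightarrow> nat \<Rightarrow> 'h" where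
  "observation g \<Delta> \<epsilon> n \<omega> i = g (real i / real n) *\<^sub>R \<Delta> + \<epsilon> (int i) \<omega>"

subsection \<open>Partial sums and the adjusted statistic\<close>

definition sample_mean :: "nat \<Rightarrow> (nat \<Rightarrow> 'a::real_vector) \<Rightarrow> 'a" where
  "sample_mean n x = (1 / real n) *\<^sub>R (\<Sum>i=1..n. x i)"

definition partial_sum :: "nat \<Rightarrow> (nat \<Rightarrow> 'a::real_vector) \<Rightarrow> nat \<Rightarrow> 'a" where
  "partial_sum n x k = (1 / sqrt (real n)) *\<^sub>R (\<Sum>i=1..k. x i - sample_mean n x)"

text \<open>Unlike \<open>sgn\<close>, this takes the value 1 at 0.\<close>

definition sign1 :: "real \<Rightarrow> real" where
  "sign1 x = (if x < 0 then - 1 else 1)"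

definition is_change_estimate :: "nat \<Rightarrow> (nat \<Rightarrow> 'h::real_normed_vector) \<Rightarrow> nat \<Rightarrow> bool" where
  "is_change_estimate n x k \<longleftrightarrow>
     k \<in> {1..<n} \<and> norm (partial_sum n x k) = (MAX l\<in>{1..<n}. norm (partial_sum n x l))"

definition change_direction :: "nat \<Rightarrow> (nat \<Rightarrow> 'h::real_vector) \<Rightarrow> nat \<Rightarrow> 'h" where
  "change_direction n x k = (1 / sqrt (real n)) *\<^sub>R partial_sum n x k"

text \<open>Here \<open>w\<close> is the first principal component and \<open>u\<close> the estimated direction of the change.\<close>

definition aligned_component :: "nat \<Rightarrow> real \<Rightarrow> 'h::real_inner \<Rightarrow> 'h \<Rightarrow> 'h" where
  "aligned_component n \<gamma> w u =
     (let y = (1 / real n powr \<gamma>) *\<^sub>R w + sign1 (inner w u) *\<^sub>R u in (1 / norm y) *\<^sub>R y)"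

definition adjusted_scores ::
    "nat \<Rightarrow> real \<Rightarrow> (nat \<Rightarrow> 'h::real_inner) \<Rightarrow> nat \<Rightarrow> (nat \<Rightarrow> 'h) \<Rightarrow> nat \<Rightarrow> nat \<Rightarrow> real" where
  "adjusted_scores n \<gamma> x k v i j =
     inner (x i) (if j = 0 then aligned_component n \<gamma> (v 0) (change_direction n x k) else v j)"

text \<open>
  Vectors in \<open>\<real>\<^sup>d\<close> are functions on \<open>{..<d}\<close> with Euclidean norm \<open>L2_set\<close>. The partial sums are formed
  componentwise and the diagonal matrix acts componentwise. The index \<open>k\<close> is the maximiser that
  determines the change-aligned component.
\<close>

definition adjusted_statistic ::
    "nat \<Rightarrow> nat \<Rightarrow> real \<Rightarrow> (nat \<Rightarrow> 'h::real_inner) \<Rightarrow> nat \<Rightarrow> (nat \<Rightarrow> real) \<Rightarrow> (nat \<Rightarrow> 'h) \<Rightarrow> ereal"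
  where
  "adjusted_statistic d n \<gamma> x k lam v =
     (if \<exists>j<d. lam j = 0 then \<infinity>
      else ereal (MAX l\<in>{1..<n}.
             L2_set (\<lambda>j. \<bar>lam j\<bar> powr (- 1 / 2) *
                        partial_sum n (\<lambda>i. adjusted_scores n \<gamma> x k v i j) l) {..<d}))"

end

theory Submission
  imports Defs
begin

text \<open>
  Write \<open>u\<close> for the direction estimate \<open>S\<^sub>k(\<eta>) / n\<^sup>1\<^sup>/\<^sup>2\<close> at the maximiser \<open>k\<close>. The sign in the aligned
  component \<open>v\<^sub>1'\<close> is chosen so that the principal component and \<open>u\<close> cannot cancel when paired with
  \<open>u\<close>: up to sign, the numerator of \<open>\<langle>u, v\<^sub>1'\<rangle>\<close> is \<open>\<bar>\<langle>v\<^sub>1, u\<rangle>\<bar> / n\<^sup>\<gamma> + \<parallel>u\<parallel>\<^sup>2\<close>, while the normalising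
  denominator is at most \<open>1 + \<parallel>u\<parallel>\<close>. Hence \<open>\<bar>\<langle>u, v\<^sub>1'\<rangle>\<bar> \<ge> \<parallel>u\<parallel>\<^sup>2 / (1 + \<parallel>u\<parallel>)\<close> for every unit vector \<open>v\<^sub>1\<close>, and
  already the first score at time \<open>k\<close> makes the statistic at least
  \<open>(n / \<bar>\<lambda>\<^sub>1\<bar>)\<^sup>1\<^sup>/\<^sup>2 \<parallel>u\<parallel>\<^sup>2 / (1 + \<parallel>u\<parallel>)\<close> (lemma \<open>adjusted_statistic_lower_bound\<close>).

  It remains to keep \<open>\<parallel>u\<parallel>\<close> away from 0. The signal contributes
  \<open>n\<^sup>-\<^sup>1 (\<Sum>i\<le>l. g(i/n)) - (l/n) n\<^sup>-\<^sup>1 (\<Sum>i\<le>n. g(i/n))\<close> at time \<open>l\<close>. With \<open>l = \<lfloor>n x\<rfloor>\<close> these Riemann sums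
  converge to \<open>\<integral>\<^sub>0\<^sup>x g - x \<integral>\<^sub>0\<^sup>1 g\<close>, which is nonzero for some \<open>x\<close> under the alternative
  (lemma \<open>signal_partial_sums_large\<close>). The noise contributes \<open>O\<^sub>P(n\<^sup>-\<^sup>1\<^sup>/\<^sup>2)\<close> uniformly in \<open>l\<close>. So
  \<open>\<parallel>u\<parallel> \<ge> c > 0\<close> with probability close to 1, and since \<open>\<lambda>\<^sub>1 = o\<^sub>P(n)\<close> the lower bound exceeds any \<open>t\<close>.
\<close>

section \<open>Partial sums\<close>

lemma partial_sum_linear:
  assumes "linear f"
  shows "partial_sum n (\<lambda>i. f (x i)) k = f (partial_sum n x k)"
  using assms
  by (simp add: partial_sum_def sample_mean_def linear_scale linear_sum linear_diff o_def)

lemma partial_sum_add: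
  "partial_sum n (\<lambda>i. x i + y i) k = partial_sum n x k + partial_sum n y k"
  by (simp add: partial_sum_def sample_mean_def sum.distrib scaleR_add_right add_diff_add)

lemma partial_sum_measurable:
  fixes x :: "nat \<Rightarrow> 'w \<Rightarrow> 'h::{real_normed_vector, second_countable_topology}"
  assumes [measurable]: "\<And>i. x i \<in> borel_measurable M"
  shows "(\<lambda>\<omega>. partial_sum n (\<lambda>i. x i \<omega>) k) \<in> borel_measurable M"
  unfolding partial_sum_def sample_mean_def by measurable

section \<open>Piecewise Lipschitz functions\<close>

lemma partition_interval_cover:
  fixes t :: "nat \<Rightarrow> real"
  assumes "t 0 \<le> y" "y \<le> t m" "y \<notin> t ` {..m}"
  shows "\<exists>i<m. t i < y \<and> y < t (Suc i)"
  using assms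
proof (induction m)
  case (Suc m)
  show ?case
  proof (cases "y \<le> t m")
    case True
    moreover from Suc.prems have "y \<notin> t ` {..m}" by auto
    ultimately show ?thesis using Suc by (meson less_SucI)
  next
    case False
    moreover from Suc.prems have "y \<noteq> t (Suc m)" by blast
    ultimately show ?thesis using Suc.prems by (intro exI[of _ m]) auto
  qed
qed auto

text \<open>
  The exceptional points are the break points. Boundedness includes them because they are finitely
  many, which matters since the Riemann sums may sample \<open>g\<close> there.
\<close>

lemma piecewise_lipschitz_regular:
  assumes "piecewise_lipschitz g"
  obtains T where "finite T" "\<And>y. y \<in> {0..1} - T \<Longrightarrow> isCont g y" "bounded (g ` {0..1})"
proof -
  from assms obtain m t where t01: "t 0 = 0" "t m = 1"
    and lip: "\<And>i. i < (m::nat) \<Longrightarrow> \<exists>L. L-lipschitz_on {t i<..<t (Suc i)} g"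
    unfolding piecewise_lipschitz_def by blast
  let ?T = "t ` {..m}"
  let ?I = "\<lambda>i. {t i<..<t (Suc i)}"
  have cover: "\<exists>i<m. y \<in> ?I i" if "y \<in> {0..1} - ?T" for y
    using partition_interval_cover[of t y m] that t01 by auto
  have "isCont g y" if "y \<in> {0..1} - ?T" for y
  proof -
    from cover[OF that] obtain i where i: "i < m" "y \<in> ?I i" by blast
    from lip[OF i(1)] obtain L where "L-lipschitz_on (?I i) g" ..
    then have "continuous_on (?I i) g" by (rule lipschitz_on_continuous_on)
    then show ?thesis using i(2) by (simp add: continuous_on_eq_continuous_at)
  qed
  moreover have "bounded (g ` {0..1})"
  proof (rule bounded_subset)
    have "bounded (g ` ?I i)" if "i < m" for i
    proof -
      from lip[OF that] obtain L where "L-lipschitz_on (?I i) g" ..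
      then have "uniformly_continuous_on (?I i) g" by (rule lipschitz_on_uniformly_continuous)
      then show ?thesis by (rule bounded_uniformly_continuous_image) simp
    qed
    then show "bounded (g ` ?T \<union> (\<Union>i<m. g ` ?I i))"
      by (auto simp: bounded_UN finite_imp_bounded)
    show "g ` {0..1} \<subseteq> g ` ?T \<union> (\<Union>i<m. g ` ?I i)"
      using cover by blast
  qed
  ultimately show thesis by (intro that[of ?T]) auto
qed

section \<open>Riemann sums\<close>

lemma grid_floor_le:
  assumes "x \<le> (1::real)"
  shows "nat \<lfloor>real n * x\<rfloor> \<le> n"
proof -
  have "real n * x \<le> real n" using assms by (simp add: mult_left_le)
  then show ?thesis by linarith
qed

text \<open>
  The Riemann sum is the integral of the step function that takes the value \<open>g(i/n)\<close> on
  \<open>((i-1)/n, i/n]\<close> and vanishes beyond the last full cell. These step functions are uniformly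
  bounded and converge to \<open>g\<close> at each point of continuity below \<open>x\<close>, so dominated convergence
  applies once the exceptional points have been removed from the domain.
\<close>

lemma riemann_sum_tendsto_integral:
  fixes g :: "real \<Rightarrow> real"
  assumes T: "finite T" and cont: "\<And>y. y \<in> {0..1} - T \<Longrightarrow> isCont g y"
    and bdd: "bounded (g ` {0..1})" and x: "0 \<le> x" "x \<le> 1"
  shows "(\<lambda>n. (1 / real n) * (\<Sum>i=1..nat \<lfloor>real n * x\<rfloor>. g (real i / real n)))
           \<longlonglongrightarrow> integral {0..x} g"
proof -
  define N where "N n = nat \<lfloor>real n * x\<rfloor>" for n :: nat
  define c where "c n y = nat \<lceil>real n * y\<rceil>" for n :: nat and y :: real
  define f where "f n y = (\<Sum>i=1..N n. g (real i / real n) *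
      (if y \<in> {real (i - 1) / real n<..real i / real n} then 1 else 0))" for n :: nat and y :: real
  define S where "S = {0..x} - (T \<union> {0, x})"
  have N_le: "real (N n) \<le> real n * x" for n
    using x by (simp add: N_def)
  have Nn: "N n \<le> n" for n
    unfolding N_def using x(2) by (rule grid_floor_le)
  obtain B where B: "\<And>y. y \<in> {0..1} \<Longrightarrow> \<bar>g y\<bar> \<le> B"
    using bdd unfolding bounded_iff by fastforce
  have B0: "0 \<le> B" using B[of 0] by force
  have f_int: "(f n has_integral (1 / real n) * (\<Sum>i=1..N n. g (real i / real n))) {0..x}" for n
  proof -
    have cell: "((\<lambda>y. if y \<in> {real (i - 1) / real n<..real i / real n} then 1 else 0::real)
        has_integral 1 / real n) {0..x}" if i: "i \<in> {1..N n}" for i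
    proof -
      have n: "real n > 0" using i Nn[of n] by auto
      have "real i \<le> real n * x" using i by (simp add: order_trans[OF _ N_le])
      then have le_x: "real i / real n \<le> x" using n by (simp add: field_simps)
      have sub: "{real (i - 1) / real n<..real i / real n} \<subseteq> {0..x}"
      proof
        fix y assume y: "y \<in> {real (i - 1) / real n<..real i / real n}"
        have "0 \<le> real (i - 1) / real n" by simp
        with y le_x show "y \<in> {0..x}"
          unfolding greaterThanAtMost_iff atLeastAtMost_iff by linarith
      qed
      have "((\<lambda>y. 1::real) has_integral (real i / real n - real (i - 1) / real n))
          {real (i - 1) / real n..real i / real n}"
        using has_integral_const_real[of "1::real" "real (i - 1) / real n" "real i / real n"] n
        by (simp add: divide_right_mono)
      moreover have "real i / real n - real (i - 1) / real n = 1 / real n"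
        using i by (simp add: of_nat_diff diff_divide_distrib)
      ultimately have "((\<lambda>y. 1::real) has_integral 1 / real n)
          {real (i - 1) / real n..real i / real n}" by simp
      then have "((\<lambda>y. 1::real) has_integral 1 / real n)
          {real (i - 1) / real n<..real i / real n}"
        by (subst has_integral_spike_set_eq[where T = "{real (i - 1) / real n..real i / real n}"])
          (auto intro: negligible_subset[of "{real (i - 1) / real n}"])
      then show ?thesis by (rule has_integral_restrict[OF sub, THEN iffD2])
    qed
    have "(f n has_integral (\<Sum>i=1..N n. g (real i / real n) * (1 / real n))) {0..x}"
      unfolding f_def
      by (intro has_integral_sum has_integral_mult_right cell) auto
    then show ?thesis by (simp add: sum_distrib_right sum_divide_distrib)
  qed
  have f_eq: "f n y = (if c n y \<in> {1..N n} then g (real (c n y) / real n) else 0)"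
    if y: "y > 0" for n y
  proof (cases "n = 0")
    case True
    then show ?thesis by (simp add: f_def N_def)
  next
    case False
    then have n: "real n > 0" by simp
    have "(y \<in> {real (i - 1) / real n<..real i / real n}) = (i = c n y)" if "i \<ge> 1" for i
    proof -
      have "(y \<in> {real (i - 1) / real n<..real i / real n}) \<longleftrightarrow>
          real i - 1 < real n * y \<and> real n * y \<le> real i"
        using n that by (auto simp: field_simps of_nat_diff)
      also have "\<dots> \<longleftrightarrow> \<lceil>real n * y\<rceil> = int i" by linarith
      also have "\<dots> \<longleftrightarrow> i = c n y" using that by (auto simp: c_def)
      finally show ?thesis .
    qed
    then have "f n y = (\<Sum>i=1..N n. if i = c n y then g (real i / real n) else 0)"
      unfolding f_def by (intro sum.cong) auto
    then show ?thesis by (simp add: sum.delta)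
  qed
  have spike: "(h has_integral I) {0..x} \<longleftrightarrow> (h has_integral I) S" for h :: "real \<Rightarrow> real" and I
    using T unfolding S_def
    by (intro has_integral_spike_set_eq negligible_finite)
      (auto intro: finite_subset[of _ "T \<union> {0, x}"])
  have "(\<lambda>n. integral S (f n)) \<longlonglongrightarrow> integral S g"
  proof (rule dominated_convergence)
    show "f n integrable_on S" for n using f_int spike by blast
    have "((\<lambda>_. B) has_integral x * B) {0..x}"
      using has_integral_const_real[of B 0 x] x by simp
    then show "(\<lambda>_. B) integrable_on S" using spike by blast
    show "norm (f n y) \<le> B" if "y \<in> S" for n y
    proof -
      have "y > 0" using that by (auto simp: S_def)
      moreover have "real (c n y) / real n \<in> {0..1}" if "c n y \<in> {1..N n}"
        using that Nn[of n] by (auto simp: divide_le_eq)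
      ultimately show ?thesis using B B0 by (simp add: f_eq)
    qed
    show "(\<lambda>n. f n y) \<longlonglongrightarrow> g y" if "y \<in> S" for y
    proof -
      from that have y: "0 < y" "y < x" and "y \<in> {0..1} - T" using x by (auto simp: S_def)
      then have "isCont g y" using cont by blast
      have lim: "(\<lambda>n. real (c n y) / real n) \<longlonglongrightarrow> y"
      proof (rule tendsto_sandwich)
        show "\<forall>\<^sub>F n in sequentially. y \<le> real (c n y) / real n"
          using eventually_gt_at_top[of 0]
        proof eventually_elim
          case (elim n)
          have "real n * y \<le> real (c n y)" unfolding c_def by linarith
          then show ?case using elim by (simp add: field_simps)
        qed
        show "\<forall>\<^sub>F n in sequentially. real (c n y) / real n \<le> y + 1 / real n"
          using eventually_gt_at_top[of 0]
        proof eventually_elim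
          case (elim n)
          have "real n * y > 0" using elim y by simp
          then have "real (c n y) \<le> real n * y + 1" unfolding c_def by linarith
          then show ?case using elim by (simp add: field_simps)
        qed
        have "(\<lambda>n. y + 1 / real n) \<longlonglongrightarrow> y + 0"
          by (intro tendsto_intros lim_1_over_n)
        then show "(\<lambda>n. y + 1 / real n) \<longlonglongrightarrow> y" by simp
      qed simp
      have "\<forall>\<^sub>F n in sequentially. real n \<ge> 2 / (x - y)"
        using filterlim_real_sequentially by (simp add: filterlim_at_top)
      then have "\<forall>\<^sub>F n in sequentially. g (real (c n y) / real n) = f n y"
        using eventually_gt_at_top[of 0]
      proof eventually_elim
        case (elim n)
        have p: "real n * y > 0" using elim y by simp
        have "2 \<le> real n * x - real n * y"
          using elim y by (simp add: field_simps)
        with p have "1 \<le> c n y" "c n y \<le> N n"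
          unfolding c_def N_def by linarith+
        then show ?case using y by (simp add: f_eq)
      qed
      then show ?thesis
        using isCont_tendsto_compose[OF \<open>isCont g y\<close> lim] by (rule Lim_transform_eventually[rotated])
    qed
  qed
  moreover have "integral S (f n) = (1 / real n) * (\<Sum>i=1..N n. g (real i / real n))" for n
    using f_int spike by (intro integral_unique) blast
  moreover have "integral S g = integral {0..x} g"
    using spike by (simp add: integral_def integrable_on_def)
  ultimately show ?thesis by (simp add: N_def)
qed

lemma partial_sum_real:
  fixes x :: "nat \<Rightarrow> real"
  assumes "n > 0"
  shows "partial_sum n x k / sqrt (real n) =
    (1 / real n) * (\<Sum>i=1..k. x i) - (real k / real n) * ((1 / real n) * (\<Sum>i=1..n. x i))"
proof -
  have "sqrt (real n) * sqrt (real n) = real n" by simp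
  then have "partial_sum n x k / sqrt (real n) = (\<Sum>i=1..k. x i - sample_mean n x) / real n"
    unfolding partial_sum_def by (simp add: divide_divide_eq_left)
  then show ?thesis
    using assms by (simp add: sum_subtractf sample_mean_def diff_divide_distrib)
qed

text \<open>
  At the end points 0 and 1 the limit vanishes, so a point \<open>x\<close> where it does not is interior and
  \<open>\<lfloor>n x\<rfloor>\<close> is eventually an admissible time.
\<close>

lemma signal_partial_sums_large:
  assumes g: "piecewise_lipschitz g" and HA: "alternative_HA g"
  obtains c where "c > 0"
    "\<forall>\<^sub>F n in sequentially. \<exists>l\<in>{1..<n}.
       c * sqrt (real n) \<le> \<bar>partial_sum n (\<lambda>i. g (real i / real n)) l\<bar>"
proof -
  obtain T where T: "finite T" "\<And>y. y \<in> {0..1} - T \<Longrightarrow> isCont g y" "bounded (g ` {0..1})"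
    using piecewise_lipschitz_regular[OF g] by blast
  define G where "G x = integral {0..x} g - x * integral {0..1} g" for x
  have "\<exists>x\<in>{0..1}. \<bar>G x\<bar> > 0"
  proof (rule ccontr)
    assume "\<not> ?thesis"
    then have "(SUP x\<in>{0..1}. \<bar>G x\<bar>) \<le> 0"
      by (intro cSUP_least) auto
    with HA show False by (simp add: alternative_HA_def G_def)
  qed
  then obtain x where x: "x \<in> {0..1}" "\<bar>G x\<bar> > 0" by blast
  have "G 0 = 0" "G 1 = 0" by (simp_all add: G_def)
  with x have x01: "0 < x" "x < 1" by (auto simp: less_le)
  define l where "l n = nat \<lfloor>real n * x\<rfloor>" for n :: nat
  let ?R = "\<lambda>n k. (1 / real n) * (\<Sum>i=1..k. g (real i / real n))"
  have 1: "(\<lambda>n. ?R n (l n)) \<longlonglongrightarrow> integral {0..x} g"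
    unfolding l_def using x01 by (intro riemann_sum_tendsto_integral[OF T]) auto
  have 2: "(\<lambda>n. ?R n n) \<longlonglongrightarrow> integral {0..1} g"
    using riemann_sum_tendsto_integral[OF T, of 1] by simp
  have 3: "(\<lambda>n. real (l n) / real n) \<longlonglongrightarrow> x"
    \<comment> \<open>the Riemann sums of the constant function 1\<close>
    using riemann_sum_tendsto_integral[of "{}" "\<lambda>_. 1" x] x01
    by (simp add: l_def image_constant_conv)
  have "(\<lambda>n. \<bar>?R n (l n) - (real (l n) / real n) * ?R n n\<bar>) \<longlonglongrightarrow> \<bar>G x\<bar>"
    unfolding G_def by (intro tendsto_intros 1 2 3)
  then have ev: "\<forall>\<^sub>F n in sequentially.
      \<bar>G x\<bar> / 2 < \<bar>?R n (l n) - (real (l n) / real n) * ?R n n\<bar>"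
    using x(2) by (intro order_tendstoD) auto
  have big: "\<forall>\<^sub>F n in sequentially. real n \<ge> 1 / x"
    using filterlim_real_sequentially by (simp add: filterlim_at_top)
  have "\<forall>\<^sub>F n in sequentially. \<exists>l\<in>{1..<n}.
      (\<bar>G x\<bar> / 2) * sqrt (real n) \<le> \<bar>partial_sum n (\<lambda>i. g (real i / real n)) l\<bar>"
    using ev big eventually_gt_at_top[of 0]
  proof eventually_elim
    case (elim n)
    have "1 \<le> real n * x" using elim x01 by (simp add: field_simps)
    moreover have "real n * x < real n" using elim x01 by simp
    ultimately have "l n \<in> {1..<n}" unfolding l_def by (simp; linarith)
    moreover have "\<bar>G x\<bar> / 2 < \<bar>partial_sum n (\<lambda>i. g (real i / real n)) (l n) / sqrt (real n)\<bar>"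
      using elim partial_sum_real[of n "\<lambda>i. g (real i / real n)" "l n"] by simp
    then have "(\<bar>G x\<bar> / 2) * sqrt (real n) \<le> \<bar>partial_sum n (\<lambda>i. g (real i / real n)) (l n)\<bar>"
      using elim by (simp add: field_simps)
    ultimately show ?case by blast
  qed
  then show thesis using x(2) that[of "\<bar>G x\<bar> / 2"] by simp
qed

section \<open>The change-aligned component\<close>

text \<open>
  Pairing with \<open>u\<close> and multiplying by the sign turns the numerator into a sum of two nonnegative
  terms; only the second one is kept.
\<close>

lemma inner_aligned_component_ge:
  assumes w: "norm w = 1" and n: "n \<ge> 1" and \<gamma>: "\<gamma> \<ge> 0" and u: "u \<noteq> 0"
  shows "(norm u)\<^sup>2 / (1 + norm u) \<le> \<bar>inner u (aligned_component n \<gamma> w u)\<bar>"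
proof -
  define a where "a = 1 / real n powr \<gamma>"
  define s where "s = sign1 (inner w u)"
  define y where "y = a *\<^sub>R w + s *\<^sub>R u"
  have s: "s * s = 1" "\<bar>s\<bar> = 1" "s * inner w u \<ge> 0"
    by (auto simp: s_def sign1_def)
  have a: "0 \<le> a" "a \<le> 1"
    using n \<gamma> by (auto simp: a_def ge_one_powr_ge_zero divide_le_eq)
  have "norm y \<le> a * norm w + \<bar>s\<bar> * norm u"
    unfolding y_def by (rule order_trans[OF norm_triangle_ineq]) (use a in simp)
  then have y_le: "norm y \<le> 1 + norm u" using a s w by simp
  have "s * inner u y = a * (s * inner w u) + (s * s) * inner u u"
    by (simp add: y_def inner_add_right inner_commute algebra_simps)
  then have "s * inner u y \<ge> (norm u)\<^sup>2"
    using a s by (simp add: power2_norm_eq_inner)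
  then have uy: "(norm u)\<^sup>2 \<le> \<bar>inner u y\<bar>"
    using s(2) by (metis abs_ge_self abs_mult mult_1 order_trans)
  then have "y \<noteq> 0" using u by auto
  then have "(norm u)\<^sup>2 / (1 + norm u) \<le> \<bar>inner u y\<bar> / norm y"
    using y_le uy by (intro frac_le) auto
  also have "\<dots> = \<bar>inner u (aligned_component n \<gamma> w u)\<bar>"
    by (simp add: aligned_component_def Let_def y_def a_def s_def abs_mult)
  finally show ?thesis .
qed

lemma adjusted_statistic_lower_bound:
  assumes d: "d \<ge> 1" and k: "k \<in> {1..<n}" and \<gamma>: "\<gamma> \<ge> 0" and v: "norm (v 0) = 1"
    and c: "c > 0" "c \<le> norm (change_direction n x k)"
    and \<delta>: "\<delta> > 0" "\<bar>lam 0\<bar> \<le> \<delta> * real n"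
  shows "ereal (c\<^sup>2 / (1 + c) / sqrt \<delta>) \<le> adjusted_statistic d n \<gamma> x k lam v"
proof (cases "\<exists>j<d. lam j = 0")
  case True
  then show ?thesis by (simp add: adjusted_statistic_def)
next
  case False
  define u where "u = change_direction n x k"
  define A where "A = aligned_component n \<gamma> (v 0) u"
  define F where "F l j = \<bar>lam j\<bar> powr (- 1 / 2) *
      partial_sum n (\<lambda>i. adjusted_scores n \<gamma> x k v i j) l" for l j
  from False d have lam: "\<bar>lam 0\<bar> > 0" by auto
  have n: "n \<ge> 1" using k by auto
  have "partial_sum n (\<lambda>i. adjusted_scores n \<gamma> x k v i 0) k = inner (partial_sum n x k) A"
    unfolding adjusted_scores_def A_def u_def
    by (simp add: partial_sum_linear[of "\<lambda>y. inner y _"] bounded_linear.linear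
        bounded_linear_inner_left)
  also have "partial_sum n x k = sqrt (real n) *\<^sub>R u"
    using n by (simp add: u_def change_direction_def)
  finally have F0: "\<bar>F k 0\<bar> = \<bar>lam 0\<bar> powr (- 1 / 2) * sqrt (real n) * \<bar>inner u A\<bar>"
    by (simp add: F_def abs_mult)
  have "c\<^sup>2 * (1 + norm u) \<le> (norm u)\<^sup>2 * (1 + c)"
  proof -
    have "c\<^sup>2 \<le> (norm u)\<^sup>2" "c * (c * norm u) \<le> norm u * (c * norm u)"
      using c by (auto simp: u_def intro!: power_mono mult_right_mono)
    then show ?thesis by (simp add: power2_eq_square algebra_simps)
  qed
  then have "c\<^sup>2 / (1 + c) \<le> (norm u)\<^sup>2 / (1 + norm u)"
    using c by (simp add: divide_simps add_pos_nonneg)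
  also have "\<dots> \<le> \<bar>inner u A\<bar>"
    unfolding A_def using v n \<gamma> c by (intro inner_aligned_component_ge) (auto simp: u_def)
  finally have uA: "c\<^sup>2 / (1 + c) \<le> \<bar>inner u A\<bar>" .
  have "sqrt \<bar>lam 0\<bar> \<le> sqrt \<delta> * sqrt (real n)"
    using \<delta> by (simp flip: real_sqrt_mult)
  then have "1 / sqrt \<delta> \<le> sqrt (real n) / sqrt \<bar>lam 0\<bar>"
    using \<delta> lam by (simp add: field_simps)
  also have "\<dots> = \<bar>lam 0\<bar> powr (- 1 / 2) * sqrt (real n)"
    using lam by (simp add: powr_minus powr_half_sqrt field_simps)
  finally have "c\<^sup>2 / (1 + c) * (1 / sqrt \<delta>) \<le> \<bar>inner u A\<bar> * (\<bar>lam 0\<bar> powr (- 1 / 2) * sqrt (real n))"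
    using uA c \<delta> by (intro mult_mono) auto
  also have "\<dots> = \<bar>F k 0\<bar>" by (simp add: F0)
  also have "\<dots> \<le> L2_set (\<lambda>j. \<bar>F k j\<bar>) {..<d}"
    using d by (intro member_le_L2_set) auto
  also have "\<dots> = L2_set (F k) {..<d}" by (simp add: L2_set_def)
  also have "\<dots> \<le> (MAX l\<in>{1..<n}. L2_set (F l) {..<d})"
    using k by (intro Max_ge) auto
  finally show ?thesis using False by (simp add: adjusted_statistic_def F_def[abs_def])
qed

text \<open>
  The exceedance event has to be measurable for its probability to dominate that of the event on
  which the lower bound holds. The time \<open>k\<close> is random, but takes countably many values, so it may
  be treated as fixed.
\<close>

lemma adjusted_statistic_measurable:
  fixes x :: "'w \<Rightarrow> nat \<Rightarrow> 'h::{real_inner, second_countable_topology}"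
  assumes x: "\<And>i. (\<lambda>\<omega>. x \<omega> i) \<in> borel_measurable M"
    and k: "k \<in> measurable M (count_space UNIV)"
    and lam [measurable]: "\<And>j. (\<lambda>\<omega>. lam \<omega> j) \<in> borel_measurable M"
    and v [measurable]: "\<And>j. (\<lambda>\<omega>. v \<omega> j) \<in> borel_measurable M"
  shows "(\<lambda>\<omega>. adjusted_statistic d n \<gamma> (x \<omega>) (k \<omega>) (lam \<omega>) (v \<omega>)) \<in> borel_measurable M"
proof (rule measurable_compose_countable[OF _ k])
  fix k :: nat
  note x [measurable]
  have [measurable]: "(\<lambda>\<omega>. change_direction n (x \<omega>) k) \<in> borel_measurable M"
    unfolding change_direction_def using partial_sum_measurable[of "\<lambda>i \<omega>. x \<omega> i", OF x]
    by measurable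
  have [measurable]: "(\<lambda>\<omega>. aligned_component n \<gamma> (v \<omega> 0) (change_direction n (x \<omega>) k))
      \<in> borel_measurable M"
    unfolding aligned_component_def Let_def sign1_def by measurable
  have "(\<lambda>\<omega>. adjusted_scores n \<gamma> (x \<omega>) k (v \<omega>) i j) \<in> borel_measurable M" for i j
    unfolding adjusted_scores_def by (cases "j = 0") simp_all
  from partial_sum_measurable[OF this] have [measurable]:
    "(\<lambda>\<omega>. partial_sum n (\<lambda>i. adjusted_scores n \<gamma> (x \<omega>) k (v \<omega>) i j) l) \<in> borel_measurable M"
    for j l .
  show "(\<lambda>\<omega>. adjusted_statistic d n \<gamma> (x \<omega>) k (lam \<omega>) (v \<omega>)) \<in> borel_measurable M"
    unfolding adjusted_statistic_def L2_set_def by measurable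
qed

section \<open>Consistency\<close>

text \<open>
  The maximiser does at least as well as a time at which the signal is large, and there the noise
  can remove only its own maximal partial sum.
\<close>

lemma change_direction_norm_ge:
  fixes \<Delta> :: "'h::real_inner"
  assumes n: "n > 0" and \<Delta>: "norm \<Delta> = 1"
    and k: "is_change_estimate n (observation g \<Delta> \<epsilon> n \<omega>) k"
    and l: "l \<in> {1..<n}" "c * sqrt (real n) \<le> \<bar>partial_sum n (\<lambda>i. g (real i / real n)) l\<bar>"
    and noise: "(MAX l\<in>{1..<n}. norm (partial_sum n (\<lambda>i. \<epsilon> (int i) \<omega>) l)) \<le> K"
  shows "c - K / sqrt (real n) \<le> norm (change_direction n (observation g \<Delta> \<epsilon> n \<omega>) k)"
proof -
  let ?x = "observation g \<Delta> \<epsilon> n \<omega>"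
  let ?e = "\<lambda>i. \<epsilon> (int i) \<omega>"
  have "partial_sum n (\<lambda>i. g (real i / real n) *\<^sub>R \<Delta>) l
      = partial_sum n (\<lambda>i. g (real i / real n)) l *\<^sub>R \<Delta>"
    by (intro partial_sum_linear) (simp add: bounded_linear.linear bounded_linear_scaleR_left)
  then have "partial_sum n ?x l
      = partial_sum n (\<lambda>i. g (real i / real n)) l *\<^sub>R \<Delta> + partial_sum n ?e l"
    unfolding observation_def[abs_def] by (simp add: partial_sum_add)
  then have "\<bar>partial_sum n (\<lambda>i. g (real i / real n)) l\<bar> - norm (partial_sum n ?e l)
      \<le> norm (partial_sum n ?x l)"
    using norm_diff_ineq[of "partial_sum n (\<lambda>i. g (real i / real n)) l *\<^sub>R \<Delta>" "partial_sum n ?e l"]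
      \<Delta> by simp
  moreover have "norm (partial_sum n ?e l) \<le> K"
    by (rule order_trans[OF _ noise]) (use l in \<open>auto intro!: Max_ge\<close>)
  moreover have "norm (partial_sum n ?x l) \<le> norm (partial_sum n ?x k)"
    using k l unfolding is_change_estimate_def by (auto intro!: Max_ge)
  ultimately have "c * sqrt (real n) - K \<le> norm (partial_sum n ?x k)"
    using l(2) by linarith
  then have "(c * sqrt (real n) - K) / sqrt (real n) \<le> norm (partial_sum n ?x k) / sqrt (real n)"
    by (rule divide_right_mono) simp
  then show ?thesis
    using n by (simp add: change_direction_def diff_divide_distrib)
qed

theorem theorem5p2:
  fixes M :: "'w measure"
    and \<epsilon> :: "int \<Rightarrow> 'w \<Rightarrow> 'h::{real_inner, banach, second_countable_topology}"
    and g :: "real \<Rightarrow> real"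
    and \<Delta> :: 'h
    and d :: nat
    and \<gamma> :: real
    and lam :: "nat \<Rightarrow> real"
    and v :: "nat \<Rightarrow> 'h"
    and C_hat :: "nat \<Rightarrow> 'w \<Rightarrow> 'h \<Rightarrow> 'h"
    and lam_hat :: "nat \<Rightarrow> 'w \<Rightarrow> nat \<Rightarrow> real"
    and v_hat :: "nat \<Rightarrow> 'w \<Rightarrow> nat \<Rightarrow> 'h"
    and k_hat :: "nat \<Rightarrow> 'w \<Rightarrow> nat"
  assumes infinite_dim: "\<not> (\<exists>B::'h set. finite B \<and> span B = UNIV)"
    and prob: "prob_space M"
    and d: "d \<ge> 1"
    and gamma: "0 < \<gamma>" "\<gamma> < 1 / 2"
    and Delta: "norm \<Delta> = 1"
    and g: "piecewise_lipschitz g"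
    and eps_measurable: "\<And>i. \<epsilon> i \<in> borel_measurable M"
    and eps_stationary: "strictly_stationary M \<epsilon>"
    and eps_centered: "\<And>i. (\<integral>\<omega>. \<epsilon> i \<omega> \<partial>M) = 0"
    and eps_moment: "integrable M (\<lambda>\<omega>. (norm (\<epsilon> 1 \<omega>))\<^sup>2)"
    and cov_summable: "(\<lambda>h. hs_norm (autocov M \<epsilon> h)) summable_on UNIV"
    and cov_spectral: "spectral_decomposition d (long_run_cov M \<epsilon>) lam v"
    and cov_eigenvalue: "lam (d - 1) > 0"
    and C_hat_measurable: "\<And>n z. n \<ge> 2 \<Longrightarrow> (\<lambda>\<omega>. C_hat n \<omega> z) \<in> borel_measurable M"
    and C_hat: "\<And>n \<omega>. n \<ge> 2 \<Longrightarrow> \<omega> \<in> space M \<Longrightarrow>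
        hilbert_schmidt (C_hat n \<omega>) \<and> self_adjoint (C_hat n \<omega>)"
    and C_hat_spectral: "\<And>n \<omega>. n \<ge> 2 \<Longrightarrow> \<omega> \<in> space M \<Longrightarrow>
        spectral_decomposition d (C_hat n \<omega>) (lam_hat n \<omega>) (v_hat n \<omega>)"
    and lam_hat_measurable: "\<And>n j. n \<ge> 2 \<Longrightarrow> (\<lambda>\<omega>. lam_hat n \<omega> j) \<in> borel_measurable M"
    and v_hat_measurable: "\<And>n j. n \<ge> 2 \<Longrightarrow> (\<lambda>\<omega>. v_hat n \<omega> j) \<in> borel_measurable M"
    and k_hat_measurable: "\<And>n. n \<ge> 2 \<Longrightarrow> k_hat n \<in> measurable M (count_space UNIV)"
    and k_hat: "\<And>n \<omega>. n \<ge> 2 \<Longrightarrow> \<omega> \<in> space M \<Longrightarrow>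
        is_change_estimate n (observation g \<Delta> \<epsilon> n \<omega>) (k_hat n \<omega>)"
    and lam_hat_rate: "small_o_P M (\<lambda>n \<omega>. lam_hat n \<omega> 0) (\<lambda>n. real n)"
    and eps_tight: "big_O_P M
        (\<lambda>n \<omega>. MAX k\<in>{1..<n}. norm (partial_sum n (\<lambda>i. \<epsilon> (int i) \<omega>) k)) (\<lambda>n. 1)"
    and HA: "alternative_HA g"
  shows "\<forall>t::real. (\<lambda>n. measure M {\<omega> \<in> space M.
            adjusted_statistic d n \<gamma> (observation g \<Delta> \<epsilon> n \<omega>)
              (k_hat n \<omega>) (lam_hat n \<omega>) (v_hat n \<omega>) > ereal t}) \<longlonglongrightarrow> 1"
proof
  fix t :: real
  interpret prob_space M by (rule prob)
  define stat where "stat n \<omega> = adjusted_statistic d n \<gamma> (observation g \<Delta> \<epsilon> n \<omega>)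
      (k_hat n \<omega>) (lam_hat n \<omega>) (v_hat n \<omega>)" for n \<omega>
  define noise where "noise n \<omega> = (MAX k\<in>{1..<n}. norm (partial_sum n (\<lambda>i. \<epsilon> (int i) \<omega>) k))"
    for n \<omega>
  obtain b where b: "b > 0" and signal: "\<forall>\<^sub>F n in sequentially. \<exists>l\<in>{1..<n}.
      b * sqrt (real n) \<le> \<bar>partial_sum n (\<lambda>i. g (real i / real n)) l\<bar>"
    using signal_partial_sums_large[OF g HA] by blast
  \<comment> \<open>Half of the signal is given up to absorb the noise; \<open>\<delta>\<close> is chosen such that the lower bound
    on the statistic becomes \<open>\<bar>t\<bar> + 1\<close>.\<close>
  define c where "c = b / 2"
  define \<delta> where "\<delta> = (c\<^sup>2 / (1 + c) / (\<bar>t\<bar> + 1))\<^sup>2"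
  have c: "c > 0" using b by (simp add: c_def)
  have r: "c\<^sup>2 / (1 + c) > 0" using c by simp
  have \<delta>: "\<delta> > 0" unfolding \<delta>_def using r c by (simp add: zero_less_power)
  have "sqrt \<delta> = c\<^sup>2 / (1 + c) / (\<bar>t\<bar> + 1)"
    unfolding \<delta>_def real_sqrt_abs using c by (intro abs_of_nonneg divide_nonneg_nonneg) auto
  moreover have "z / (z / (\<bar>t\<bar> + 1)) = \<bar>t\<bar> + 1" if "z > 0" for z
    using that by simp
  ultimately have "c\<^sup>2 / (1 + c) / sqrt \<delta> = \<bar>t\<bar> + 1" using r by metis
  then have bound: "c\<^sup>2 / (1 + c) / sqrt \<delta> > t" by linarith
  have stat_meas: "stat n \<in> borel_measurable M" if "n \<ge> 2" for n
    unfolding stat_def[abs_def]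
    by (intro adjusted_statistic_measurable k_hat_measurable lam_hat_measurable v_hat_measurable that)
      (auto simp: observation_def intro: borel_measurable_add eps_measurable)
  have noise_meas: "noise n \<in> borel_measurable M" for n
    unfolding noise_def[abs_def]
    using partial_sum_measurable[where x = "\<lambda>i. \<epsilon> (int i)" and M = M] eps_measurable
    by (intro borel_measurable_Max borel_measurable_norm) simp_all
  show "(\<lambda>n. measure M {\<omega> \<in> space M. adjusted_statistic d n \<gamma> (observation g \<Delta> \<epsilon> n \<omega>)
      (k_hat n \<omega>) (lam_hat n \<omega>) (v_hat n \<omega>) > ereal t}) \<longlonglongrightarrow> 1"
    unfolding stat_def[symmetric]
  proof (rule order_tendstoI)
    fix a :: real assume "a < 1"
    define e where "e = (1 - a) / 2"
    have e: "e > 0" using \<open>a < 1\<close> by (simp add: e_def)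
    obtain K where K: "\<forall>\<^sub>F n in sequentially. measure M {\<omega> \<in> space M. \<bar>noise n \<omega>\<bar> > K} < e"
      using eps_tight e unfolding big_O_P_def noise_def by (auto dest!: spec[of _ e])
    have "(\<lambda>n. measure M {\<omega> \<in> space M. \<bar>lam_hat n \<omega> 0\<bar> > \<delta> * real n}) \<longlonglongrightarrow> 0"
      using lam_hat_rate \<delta> unfolding small_o_P_def by blast
    then have L: "\<forall>\<^sub>F n in sequentially. measure M {\<omega> \<in> space M. \<bar>lam_hat n \<omega> 0\<bar> > \<delta> * real n} < e"
      using e by (rule order_tendstoD)
    have "(\<lambda>n. K / sqrt (real n)) \<longlonglongrightarrow> 0"
      by (intro tendsto_divide_0[OF tendsto_const] filterlim_at_top_imp_at_infinity
          filterlim_compose[OF sqrt_at_top filterlim_real_sequentially])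
    then have "\<forall>\<^sub>F n in sequentially. K / sqrt (real n) < c"
      using c by (rule order_tendstoD)
    then show "\<forall>\<^sub>F n in sequentially. a < measure M {\<omega> \<in> space M. stat n \<omega> > ereal t}"
      using K L signal eventually_ge_at_top[of 2]
    proof eventually_elim
      case (elim n)
      let ?A = "{\<omega> \<in> space M. \<bar>noise n \<omega>\<bar> > K}"
      let ?B = "{\<omega> \<in> space M. \<bar>lam_hat n \<omega> 0\<bar> > \<delta> * real n}"
      let ?E = "{\<omega> \<in> space M. stat n \<omega> > ereal t}"
      note [measurable] = noise_meas stat_meas[OF elim(5)] lam_hat_measurable[OF elim(5)]
      from elim(4) obtain l where l: "l \<in> {1..<n}"
        "b * sqrt (real n) \<le> \<bar>partial_sum n (\<lambda>i. g (real i / real n)) l\<bar>" by blast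
      have "\<omega> \<in> ?E" if \<omega>: "\<omega> \<in> space M" "\<omega> \<notin> ?A" "\<omega> \<notin> ?B" for \<omega>
      proof -
        note est = k_hat[OF elim(5) \<omega>(1)]
        have "noise n \<omega> \<le> K" using \<omega> by auto
        then have "b - K / sqrt (real n) \<le> norm (change_direction n (observation g \<Delta> \<epsilon> n \<omega>) (k_hat n \<omega>))"
          using elim(5) by (intro change_direction_norm_ge[OF _ Delta est l]) (auto simp: noise_def)
        then have u: "c \<le> norm (change_direction n (observation g \<Delta> \<epsilon> n \<omega>) (k_hat n \<omega>))"
          using elim(1) by (simp add: c_def)
        have "inner (v_hat n \<omega> 0) (v_hat n \<omega> 0) = 1"
          using C_hat_spectral[OF elim(5) \<omega>(1)]
          by (simp add: spectral_decomposition_def orthonormal_basis_def)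
        then have "norm (v_hat n \<omega> 0) = 1" by (simp add: norm_eq_sqrt_inner)
        then have "ereal (c\<^sup>2 / (1 + c) / sqrt \<delta>) \<le> stat n \<omega>"
          unfolding stat_def using \<omega> est gamma d c u \<delta>
          by (intro adjusted_statistic_lower_bound) (auto simp: is_change_estimate_def)
        moreover have "ereal t < ereal (c\<^sup>2 / (1 + c) / sqrt \<delta>)" using bound by simp
        ultimately have "ereal t < stat n \<omega>" by (rule less_le_trans[rotated])
        then show ?thesis using \<omega>(1) by simp
      qed
      then have "space M - ?E \<subseteq> ?A \<union> ?B" by blast
      then have "prob (space M - ?E) \<le> prob (?A \<union> ?B)"
        by (rule finite_measure_mono) measurable
      also have "\<dots> \<le> prob ?A + prob ?B"
        by (rule measure_Un_le) measurable
      also have "\<dots> < 2 * e" using elim(2,3) by simp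
      finally show ?case
        using prob_compl[of ?E] by (simp add: e_def)
    qed
  qed (auto intro: always_eventually le_less_trans[OF prob_le_1])
qed

end
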